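(* Let $G$ be a simple 2-connected graph of order $n\ge 10$. If $G$ is $\{K_{1,3}, Z_2\}$-free, then either $G$ is the cycle $C_n$ or $G$ is chorded pancyclic.
   Context: For graphs $H_1,\dots,H_r$, $G$ is $\{H_1,\dots,H_r\}$-free if $G$ contains no induced subgraph isomorphic to any $H_i$. $K_{1,3}$ is the claw (star with three leaves). $P_i$ denotes the path on $i$ vertices, and $Z_i$ denotes the graph obtained from a triangle by attaching a pendant path $P_i$ to one vertex of the triangle (i.e., one endpoint of a path on $i$ new vertices is joined by an edge to one triangle vertex); so $Z_2$ has 5 vertices. A chorded cycle is a cycle $C$ such that $G$ has an edge joining two vertices nonconsecutive on $C$. A graph $G$ of order $n$ is chorded pancyclic if it contains a chorded cycle of every length $m$ with $4\le m\le n$. *)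

theory Defs
  imports "Graph_Theory.Graph_Theory"
begin

text \<open>Finite simple graphs are the symmetric loop-free digraphs
  \<^locale>\<open>pair_graph\<close>; the undirected edge \<open>uv\<close> is the pair of arcs \<open>(u,v)\<close>, \<open>(v,u)\<close>.\<close>

definition undirected :: "'a set \<Rightarrow> 'a rel \<Rightarrow> 'a pair_pre_digraph" where
  "undirected V E = \<lparr>pverts = V, parcs = E \<union> E\<inverse>\<rparr>"

definition claw :: "nat pair_pre_digraph" where
  "claw = undirected {0, 1, 2, 3} {(0, 1), (0, 2), (0, 3)}"

text \<open>Triangle \<open>0, 1, 2\<close>; the attached path is \<open>3, \<dots>, i + 2\<close>, with \<open>3\<close> joined to \<open>2\<close>.\<close>

definition Z_graph :: "nat \<Rightarrow> nat pair_pre_digraph" where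
  "Z_graph i = undirected {..<i + 3}
     ({(0, 1), (0, 2), (1, 2)} \<union> {(j, j + 1) |j. 2 \<le> j \<and> j < i + 2})"

text \<open>Meaningful for \<open>n \<ge> 3\<close>.\<close>

definition cycle_graph :: "nat \<Rightarrow> nat pair_pre_digraph" where
  "cycle_graph n = undirected {..<n} {(i, (i + 1) mod n) |i. i < n}"

definition free_of :: "'b pair_pre_digraph set \<Rightarrow> 'a pair_pre_digraph \<Rightarrow> bool" where
  "free_of \<H> G \<longleftrightarrow>
     (\<forall>H\<in>\<H>. \<not> (\<exists>S \<subseteq> pverts G. digraph_iso (with_proj G \<restriction> S) (with_proj H)))"

definition k_connected :: "nat \<Rightarrow> 'a pair_pre_digraph \<Rightarrow> bool" where
  "k_connected k G \<longleftrightarrow> k < card (pverts G) \<and>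
     (\<forall>X \<subseteq> pverts G. card X < k \<longrightarrow> connected (with_proj G \<restriction> (pverts G - X)))"

text \<open>The library regards \<open>u, v, u\<close> as a cycle of length 2, hence the bound on the length.
  Two vertices of a cycle are consecutive on it iff one of the two arcs between them is traversed.\<close>

definition chorded_cycle :: "'a pair_pre_digraph \<Rightarrow> ('a \<times> 'a) awalk \<Rightarrow> bool" where
  "chorded_cycle G p \<longleftrightarrow> pre_digraph.cycle (with_proj G) p \<and> 3 \<le> length p \<and>
     (\<exists>u v. u \<in> fst ` set p \<and> v \<in> fst ` set p \<and> (u, v) \<in> parcs G \<and>
        (u, v) \<notin> set p \<and> (v, u) \<notin> set p)"

definition chorded_pancyclic :: "'a pair_pre_digraph \<Rightarrow> bool" where
  "chorded_pancyclic G \<longleftrightarrow>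
     (\<forall>m. 4 \<le> m \<and> m \<le> card (pverts G) \<longrightarrow> (\<exists>p. chorded_cycle G p \<and> length p = m))"

lemma claw_complete_bipartite: "complete_bipartite_digraph 1 3 (with_proj claw)"
  unfolding complete_bipartite_digraph_pair_def
  by (rule conjI, simp add: claw_def undirected_def,
      rule exI[of _ "{0}"], rule exI[of _ "{1, 2, 3}"])
     (auto simp: claw_def undirected_def)

lemma pair_graph_Z_graph: "pair_graph (Z_graph i)"
proof -
  have "parcs (Z_graph i) \<subseteq> pverts (Z_graph i) \<times> pverts (Z_graph i)"
    by (auto simp: Z_graph_def undirected_def)
  moreover have "finite (pverts (Z_graph i))"
    by (simp add: Z_graph_def undirected_def)
  ultimately have "finite (parcs (Z_graph i))"
    by (meson finite_SigmaI finite_subset)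
  then show ?thesis
    by unfold_locales (auto simp: Z_graph_def undirected_def symmetric_def intro!: symI)
qed

lemma pair_graph_cycle_graph:
  assumes "n \<ge> 3"
  shows "pair_graph (cycle_graph n)"
proof -
  have ne: "i \<noteq> Suc i mod n" if "i < n" for i
    using that assms by (cases "Suc i = n") auto
  have sub: "parcs (cycle_graph n) \<subseteq> pverts (cycle_graph n) \<times> pverts (cycle_graph n)"
    using assms by (auto simp: cycle_graph_def undirected_def)
  moreover have "finite (pverts (cycle_graph n))"
    by (simp add: cycle_graph_def undirected_def)
  ultimately have "finite (parcs (cycle_graph n))"
    by (meson finite_SigmaI finite_subset)
  moreover have "fst e \<noteq> snd e" if "e \<in> parcs (cycle_graph n)" for e
    using that ne by (auto simp: cycle_graph_def undirected_def) metis
  moreover have "sym (parcs (cycle_graph n))"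
    by (auto simp: cycle_graph_def undirected_def intro!: symI)
  ultimately show ?thesis
    using sub \<open>finite (pverts (cycle_graph n))\<close>
    by unfold_locales (auto simp: symmetric_def)
qed

end

theory Submission
  imports Defs
begin

text \<open>Every cycle of length \<open>m\<close> with \<open>4 \<le> m < n\<close> yields a chorded cycle of length \<open>m + 1\<close>. Suppose not,
  and let \<open>v\<close> off the cycle be adjacent to \<open>x\<close> on it, where \<open>x\<^sup>-\<close> and \<open>x\<^sup>+\<close> are the neighbours of
  \<open>x\<close> on the cycle. Then \<open>v\<close> is adjacent to neither of them, so \<open>x\<^sup>-x\<^sup>+\<close> is an edge by
  claw-freeness. Applied to the triangle \<open>x\<^sup>-, x, x\<^sup>+\<close> with the path starting at \<open>v\<close>, \<open>Z\<^sub>2\<close>-freeness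
  shows first that \<open>x\<close> is the only neighbour of \<open>v\<close> on the cycle and then, by 2-connectivity, that an
  edge \<open>vw\<close> off the cycle attaches to consecutive vertices of it. One can detour through \<open>v, w\<close> and
  bypass one vertex. It remains to find a first chorded 4-cycle: a graph that is not a cycle contains
  a triangle by claw-freeness, and a triangle forces a diamond once \<open>n \<ge> 10\<close>.\<close>

section \<open>Cycles as vertex lists\<close>

locale ugraph =
  fixes V :: "'a set" and adj :: "'a \<Rightarrow> 'a \<Rightarrow> bool"
  assumes fin: "finite V"
    and adj_sym: "adj u v \<Longrightarrow> adj v u"
    and adj_irrefl [simp]: "\<not> adj v v"
    and adj_in: "adj u v \<Longrightarrow> u \<in> V"
begin

lemma adj_in2: "adj u v \<Longrightarrow> v \<in> V"
  using adj_in adj_sym by blast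

lemma adj_commute: "adj u v \<longleftrightarrow> adj v u"
  using adj_sym by blast

definition cyc :: "'a list \<Rightarrow> bool" where
  "cyc xs \<longleftrightarrow> distinct xs \<and> 3 \<le> length xs \<and> successively adj xs \<and> adj (last xs) (hd xs)"

text \<open>By rotation the chord may be taken to start at the head \<open>x\<close>. Its other end
  lies in \<open>B\<close>, strictly between the cycle neighbours \<open>w\<close> and
  \<open>l\<close> of \<open>x\<close>.\<close>

definition chorded_cyc :: "nat \<Rightarrow> bool" where
  "chorded_cyc m \<longleftrightarrow> (\<exists>x w B l z. cyc (x # w # B @ [l]) \<and> z \<in> set B \<and> adj x z \<and>
     length (x # w # B @ [l]) = m)"

lemma chorded_cycI:
  assumes "cyc (x # w # L)" "z \<in> set L" "z \<noteq> last L" "adj x z" "length (x # w # L) = m"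
  shows "chorded_cyc m"
proof -
  have L: "L = butlast L @ [last L]"
    using assms(2) by (metis append_butlast_last_id empty_iff empty_set)
  have "z \<in> set (butlast L)"
    using assms(2,3) by (metis L Un_iff empty_iff empty_set insert_iff list.simps(15) set_append)
  then show ?thesis
    unfolding chorded_cyc_def using assms L by metis
qed

lemma cyc_rotate: "cyc (A @ B) \<Longrightarrow> cyc (B @ A)"
  by (cases "A = []"; cases "B = []") (auto simp: cyc_def successively_append_iff)

lemma successively_adj_rev: "successively adj (rev xs) = successively adj xs"
  by (simp add: adj_commute)

lemma cyc_rev:
  assumes "cyc (x # L)" shows "cyc (x # rev L)"
proof -
  have "L \<noteq> []" using assms by (auto simp: cyc_def)
  then have "successively adj (rev L)" "adj x (last L)" "adj x (hd L)"
    using assms successively_adj_rev by (auto simp: cyc_def successively_Cons adj_commute)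
  then show ?thesis
    using assms \<open>L \<noteq> []\<close> by (auto simp: cyc_def successively_Cons hd_rev last_rev adj_commute)
qed

lemma cyc_subset:
  assumes "cyc xs" shows "set xs \<subseteq> V"
proof
  fix x assume "x \<in> set xs"
  then obtain A B where xs: "xs = A @ x # B" by (meson split_list)
  then have "cyc (x # B @ A)" using assms cyc_rotate by fastforce
  then show "x \<in> V" by (metis adj_in2 cyc_def list.sel(1))
qed

lemma cyc_nth:
  assumes "cyc xs" "i < length xs"
  shows "adj (xs ! i) (xs ! (Suc i mod length xs))"
proof (cases "Suc i = length xs")
  case True
  then have "xs ! i = last xs" "xs ! (Suc i mod length xs) = hd xs"
    using assms by (simp_all add: cyc_def hd_conv_nth last_conv_nth flip: True length_greater_0_conv)
  then show ?thesis using assms by (simp add: cyc_def)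
next
  case False
  then show ?thesis using assms by (auto simp: cyc_def successively_conv_nth)
qed

end

section \<open>Lengthening a cycle by one vertex\<close>

text \<open>A forbidden induced subgraph appears as a forced extra edge; all other vertices are
  distinct because they are adjacent. \<open>connected\<close> is the cut form of
  2-connectivity.\<close>

locale two_connected_claw_Z2_free = ugraph +
  assumes claw_free: "\<lbrakk>adj x a; adj x b; adj x c; a \<noteq> b; a \<noteq> c; b \<noteq> c\<rbrakk> \<Longrightarrow> adj a b \<or> adj a c \<or> adj b c"
    and Z2_free: "\<lbrakk>adj a b; adj b c; adj a c; adj c d; adj d e; d \<notin> {a, b}; e \<notin> {a, b, c}\<rbrakk>
      \<Longrightarrow> adj d a \<or> adj d b \<or> adj e a \<or> adj e b \<or> adj e c"
    and connected: "\<lbrakk>X \<subseteq> V; card X < 2; S \<subseteq> V - X; S \<noteq> {}; S \<noteq> V - X\<rbrakk>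
      \<Longrightarrow> \<exists>u\<in>S. \<exists>t\<in>V - X - S. adj u t"
    and order: "10 \<le> card V"
begin

text \<open>Inserting \<open>v\<close> between \<open>x\<close> and a cycle neighbour lengthens the
  cycle by one, to \<open>length L + 2\<close>, and turns the bypassed edge into a chord. So
  \<open>v\<close> misses both neighbours, and claw-freeness at \<open>x\<close> joins them.\<close>

lemma outside_neighbour_not_consecutive:
  assumes C: "cyc (x # L)" and v: "adj v x" "v \<notin> set (x # L)" and len: "3 \<le> length L"
    and no: "\<not> chorded_cyc (length L + 2)"
  shows "\<not> adj v (hd L)" "\<not> adj v (last L)" "adj (hd L) (last L)"
proof -
  have step: "\<not> adj v (hd M)" if "cyc (x # M)" "v \<notin> set M" "length M = length L" for M
  proof
    assume h: "adj v (hd M)"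
    have ne: "M \<noteq> []" "hd M \<noteq> last M" "last M \<in> set M" "hd M \<in> set M"
      using that len by (cases M; auto simp: cyc_def)+
    have "cyc (x # v # M)"
      using that h v ne by (auto simp: cyc_def successively_Cons adj_commute)
    moreover have "adj x (hd M)" using that ne by (auto simp: cyc_def successively_Cons)
    ultimately show False using no ne that chorded_cycI[of x v M "hd M"] by simp
  qed
  show 1: "\<not> adj v (hd L)" using step C v by simp
  show 2: "\<not> adj v (last L)" using step[OF cyc_rev[OF C]] v by (simp add: hd_rev)
  have ne: "L \<noteq> []" "hd L \<noteq> last L" "last L \<in> set L" "hd L \<in> set L"
    using C len by (cases L; auto simp: cyc_def)+
  have "adj x (hd L)" "adj x (last L)"
    using C ne by (auto simp: cyc_def successively_Cons adj_commute)
  moreover have "v \<noteq> hd L" "v \<noteq> last L" using v ne by auto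
  ultimately show "adj (hd L) (last L)"
    using claw_free[of x v "hd L" "last L"] 1 2 v ne by (auto simp: adj_commute)
qed

text \<open>For two attachments \<open>x\<close> and \<open>y\<close> of \<open>v\<close>, the edges
  joining the two cycle neighbours of each let the segments \<open>A\<close> and \<open>B\<close> be
  rejoined around the detour \<open>x, v, y\<close>, with no vertex lost.\<close>

lemma outside_neighbour_unique:
  assumes C: "cyc (x # L)" and v: "adj v x" "v \<notin> set (x # L)" and len: "3 \<le> length L"
    and no: "\<not> chorded_cyc (length L + 2)" and y: "y \<in> set L"
  shows "\<not> adj v y"
proof
  assume "adj v y"
  then obtain A y B where L: "L = A @ y # B" and vy: "adj v y" and A: "\<forall>a\<in>set A. \<not> adj v a"
    using split_list_first_prop[of L "adj v"] y by blast
  have Cx: "cyc (x # A @ y # B)" using C L by simp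
  have Cy: "cyc (y # B @ x # A)" using cyc_rotate[of "x # A" "y # B"] Cx by simp
  note fx = outside_neighbour_not_consecutive[OF C v len no]
  have ne: "A \<noteq> []" "B \<noteq> []" using fx L vy by auto
  have lenY: "length (B @ x # A) = length L" using L by simp
  have fy: "adj (hd B) (last A)"
    using outside_neighbour_not_consecutive(3)[OF Cy vy] v no len L ne unfolding lenY by simp
  have xA: "adj x (hd A)" and xB: "adj x (last B)" and AB: "adj (last B) (hd A)"
    and yA: "adj y (last A)" and yB: "adj y (hd B)"
    using Cx fx L ne by (auto simp: cyc_def successively_Cons successively_append_iff adj_commute)
  have sA: "successively adj A" and sB: "successively adj B"
    using Cx by (auto simp: cyc_def successively_Cons successively_append_iff)
  have dist: "distinct (v # x # A @ y # B)" using v L Cx by (auto simp: cyc_def)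
  have hd_last: "hd A \<in> set A" "last A \<in> set A" "hd B \<in> set B" "last B \<in> set B" using ne by auto
  have len': "length L = length A + length B + 1" using L by simp
  \<comment> \<open>The segments \<open>A\<close> and \<open>B\<close> are joined by the edge
    \<open>fy\<close>, and the bypassed edge from \<open>x\<close> to \<open>hd A\<close> is the
    chord. The claim for \<open>last B\<close> traverses both segments backwards.\<close>
  have y1: "\<not> adj y (hd A)"
  proof
    assume "adj y (hd A)"
    then have "cyc (x # v # y # A @ B)"
      using dist ne sA sB v vy fy xB
      by (auto simp: cyc_def successively_Cons successively_append_iff adj_commute)
    moreover have "hd A \<noteq> last B" using dist hd_last by auto
    ultimately show False
      using chorded_cycI[of x v "y # A @ B" "hd A"] no len' ne xA hd_last by auto
  qed
  have y2: "\<not> adj y (last B)"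
  proof
    assume "adj y (last B)"
    then have "cyc (x # v # y # rev B @ rev A)"
      using dist ne sA sB v vy fy xA
      by (auto simp: cyc_def successively_Cons successively_append_iff successively_adj_rev
          adj_commute hd_rev last_rev simp del: successively_rev)
    moreover have "last B \<noteq> hd A" using dist hd_last by auto
    ultimately show False
      using chorded_cycI[of x v "y # rev B @ rev A" "last B"] no len' ne xB hd_last add.commute[of "length A"]
      by (auto simp: last_rev)
  qed
  have "v \<noteq> hd A" "v \<noteq> last B" "y \<noteq> hd A" "y \<noteq> last B" using dist hd_last by auto
  \<comment> \<open>For the triangle \<open>hd A, last B, x\<close> with the path
    \<open>v, y\<close>, every other extra edge has been excluded.\<close>
  then have xy: "adj x y"
    using Z2_free[of "hd A" "last B" x v y] xA xB AB y1 y2 v vy fx L ne dist hd_last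
    by (auto simp: adj_commute)
  txt \<open>With \<open>z\<close> the first neighbour of \<open>y\<close> after \<open>x\<close>, the vertices \<open>K\<close> between \<open>x\<close> and \<open>z\<close> are all
    adjacent to \<open>x\<close>, so \<open>K\<close> can be moved between \<open>x\<^sup>-\<close> and \<open>x\<close>.\<close>
  obtain K z Z where K: "A = K @ z # Z" "adj y z" "\<forall>k\<in>set K. \<not> adj y k"
    using split_list_first_prop[of A "adj y"] yA hd_last by blast
  have Kx: "adj x (K ! i)" if "i < length K" for i
    using that
  proof (induction i)
    case 0
    then show ?case using xA K by (cases K) auto
  next
    case (Suc i)
    have "adj (K ! i) (K ! Suc i)"
      using sA K Suc.prems by (auto simp: successively_append_iff intro: successively_nth)
    moreover have "K ! i \<in> set K" "K ! Suc i \<in> set K" using Suc.prems by auto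
    moreover have "k \<noteq> v" "k \<noteq> x" "k \<noteq> y" if "k \<in> set K" for k using that K dist by auto
    \<comment> \<open>In the triangle \<open>v, y, x\<close> with the path
      \<open>K ! i, K ! Suc i\<close>, \<open>v\<close> misses \<open>A\<close> and \<open>y\<close>
      misses \<open>K\<close>, so only an edge to \<open>x\<close> remains.\<close>
    ultimately show ?case
      using Z2_free[of v y x "K ! i" "K ! Suc i"] Suc v vy xy K A dist
      by (auto simp: adj_commute)
  qed
  have Kne: "K \<noteq> []" using K y1 by auto
  have lastK: "adj x (last K)" using Kx[of "length K - 1"] Kne by (simp add: last_conv_nth)
  have "cyc (x # v # y # (z # Z) @ B @ K)"
    using dist ne sA sB v vy fy xA lastK K AB Kne
    by (auto simp: cyc_def successively_Cons successively_append_iff adj_commute hd_append)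
  moreover have "last B \<noteq> last K" using dist hd_last K Kne by (auto dest: last_in_set)
  moreover have "length (x # v # y # (z # Z) @ B @ K) = length L + 2" using len' K by simp
  ultimately show False
    using chorded_cycI[of x v "y # (z # Z) @ B @ K" "last B" "length L + 2"] no Kne xB hd_last(4)
    by simp
qed

text \<open>The detour \<open>x, v, w, y\<close> adds two vertices, so one vertex of
  \<open>M\<close> has to be skipped. As \<open>v\<close> and \<open>w\<close> have no further
  neighbours on the cycle, claw-freeness makes the other neighbours of \<open>x\<close> on it a
  clique, and likewise for \<open>y\<close>.\<close>

lemma consecutive_attachments_extend:
  assumes C: "cyc (x # y # M)" and len: "2 \<le> length M"
    and v: "adj v x" "v \<notin> set (x # y # M)" and w: "adj w y" "w \<notin> set (x # y # M)" and vw: "adj v w"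
  shows "chorded_cyc (length M + 3)"
proof (rule ccontr)
  assume no: "\<not> chorded_cyc (length M + 3)"
  then have no': "\<not> chorded_cyc (length (y # M) + 2)" "\<not> chorded_cyc (length (M @ [x]) + 2)"
    by (simp_all add: numeral_3_eq_3)
  have Cy: "cyc (y # M @ [x])" using cyc_rotate[of "[x]" "y # M"] C by simp
  have ux: "\<not> adj v u" if "u \<in> set (y # M)" for u
    using outside_neighbour_unique[OF C v] len no' that by simp
  have uy: "\<not> adj w u" if "u \<in> set (M @ [x])" for u
    using outside_neighbour_unique[OF Cy w(1)] w(2) len no' that by simp
  have ne: "M \<noteq> []" "hd M \<in> set M" "last M \<in> set M" using len by (cases M; auto)+
  have fx: "adj y (last M)"
    using outside_neighbour_not_consecutive(3)[OF C v] len no' ne by simp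
  have fy: "adj (hd M) x"
    using outside_neighbour_not_consecutive(3)[OF Cy w(1)] w(2) len no' ne by simp
  have dist: "distinct (v # w # x # y # M)" using C v w vw by (auto simp: cyc_def)
  have adjs: "adj x y" "adj y (hd M)" "adj x (last M)" "successively adj M"
    using C ne by (auto simp: cyc_def successively_Cons adj_commute)
  have clique_x: "adj p q" if "adj x p" "adj x q" "p \<noteq> q" "p \<in> set (y # M)" "q \<in> set (y # M)" for p q
    using claw_free[of x v p q] that v ux by (auto simp: adj_commute)
  have clique_y: "adj p q" if "adj y p" "adj y q" "p \<noteq> q" "p \<in> set (x # M)" "q \<in> set (x # M)" for p q
    using claw_free[of y w p q] that w uy by (auto simp: adj_commute)
  \<comment> \<open>Here \<open>N\<close> is \<open>M\<close> with one vertex removed, possibly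
    reordered; the edge \<open>xy\<close> is the chord.\<close>
  have chord: "\<not> cyc (x # v # w # y # N)" if "length N = length M - 1" "N \<noteq> []" "set N \<subseteq> set M" for N
  proof
    assume *: "cyc (x # v # w # y # N)"
    have "last N \<in> set M" using that by auto
    then have "y \<noteq> last N" using dist by auto
    have len': "length (x # v # w # y # N) = length M + 3" using that len by simp
    show False
      using chorded_cycI[OF * _ _ _ len', of y] \<open>y \<noteq> last N\<close> adjs no that by (simp add: adj_commute)
  qed
  show False
  proof (cases "length M = 2")
    case True
    have "cyc (x # v # w # y # [last M])"
      using dist v w vw fx adjs ne by (auto simp: cyc_def adj_commute)
    then show False using chord[of "[last M]"] True ne by simp
  next
    case False
    define r where "r = last M"
    define s where "s = last (butlast M)"
    define N where "N = butlast (butlast M)"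
    have M: "M = N @ [s, r]"
      using len unfolding r_def s_def N_def
      by (metis One_nat_def append.assoc append_Cons append_Nil append_butlast_last_id diff_is_0_eq
          length_butlast list.size(3) ne(1) not_less_eq_eq numeral_2_eq_2)
    have N: "N \<noteq> []" using False M len by auto
    define q where "q = last N"
    have q: "q \<in> set N" "hd N \<in> set N" using N q_def by auto
    have a: "adj y r" "adj x r" "adj s r" "adj q s" "adj (hd N) x" "adj y (hd N)" "successively adj N"
      using fx fy adjs M N by (auto simp: successively_append_iff successively_Cons q_def)
    \<comment> \<open>Otherwise \<open>r\<close> can be skipped. The same holds if \<open>s\<close>
      is adjacent to \<open>y\<close>: then \<open>N\<close> is traversed backwards and closed by
      the edge from \<open>hd N\<close> to \<open>x\<close>.\<close>
    have "\<not> adj s x"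
    proof
      assume "adj s x"
      then have "cyc (x # v # w # y # N @ [s])"
        using dist v w vw M N a by (auto simp: cyc_def successively_Cons successively_append_iff adj_commute q_def)
      then show False using chord[of "N @ [s]"] M by auto
    qed
    moreover have "\<not> adj s y"
    proof
      assume "adj s y"
      then have "cyc (x # v # w # y # s # rev N)"
        using dist v w vw M N a
        by (auto simp: cyc_def successively_Cons successively_adj_rev hd_rev last_rev
            adj_commute q_def simp del: successively_rev)
      then show False using chord[of "s # rev N"] M by auto
    qed
    \<comment> \<open>\<open>Z2_free\<close> for the triangle \<open>x, y, r\<close> with the path
      \<open>s, q\<close>. The clique properties reduce all three cases to the edge
      \<open>qr\<close>, which skips \<open>s\<close>.\<close>
    ultimately have "adj q x \<or> adj q y \<or> adj q r"
      using Z2_free[of x y r s q] a adjs dist M q by (auto simp: adj_commute)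
    then have "adj q r"
      using clique_x[of q r] clique_y[of q r] a dist M q by (auto simp: adj_commute)
    then have "cyc (x # v # w # y # N @ [r])"
      using dist v w vw M N a by (auto simp: cyc_def successively_Cons successively_append_iff adj_commute q_def)
    then show False using chord[of "N @ [r]"] M by auto
  qed
qed

text \<open>As \<open>x\<close> is no cut vertex, an edge \<open>ut\<close> leaves the set
  \<open>S\<close> of its neighbours off the cycle without using \<open>x\<close>. Then
  \<open>t\<close> is off the cycle too, and \<open>Z2_free\<close> attaches it to a cycle neighbour
  of \<open>x\<close>.\<close>

lemma cyc_extend:
  assumes C: "cyc xs" and len: "4 \<le> length xs" "length xs < card V"
  shows "chorded_cyc (Suc (length xs))"
proof (rule ccontr)
  assume no: "\<not> chorded_cyc (Suc (length xs))"
  have "set xs \<noteq> V" using len(2) card_length[of xs] by auto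
  moreover have "xs \<noteq> []" using len(1) by auto
  ultimately obtain x v where xv: "x \<in> set xs" "v \<in> V - set xs" "adj x v"
    using connected[of "{}" "set xs"] cyc_subset[OF C] by auto
  obtain A B where AB: "xs = A @ x # B" using xv by (meson split_list)
  define L where "L = B @ A"
  have CL: "cyc (x # L)" using cyc_rotate[of A "x # B"] C AB L_def by simp
  have set: "set xs = set (x # L)" and lL: "length xs = Suc (length L)" using AB L_def by auto
  define S where "S = {u \<in> V - set xs. adj u x}"
  have unique: "\<not> adj u z" if "u \<in> S" "z \<in> set L" for u z
    using outside_neighbour_unique[OF CL] that S_def set lL len no by auto
  have ne: "L \<noteq> []" "hd L \<noteq> last L" "hd L \<in> set L" "last L \<in> set L"
    using CL lL len by (cases L; auto simp: cyc_def)+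
  have xL: "adj x (hd L)" "adj x (last L)"
    using CL ne by (auto simp: cyc_def successively_Cons adj_commute)
  have "S \<subseteq> V - {x}" "v \<in> S" "hd L \<in> V - {x} - S"
    using S_def xv ne set cyc_subset[OF C] xL by (auto simp: adj_commute)
  then obtain u t where u: "u \<in> S" and t: "t \<in> V - {x} - S" and ut: "adj u t"
    using connected[of "{x}" S] xv(1) cyc_subset[OF C] by auto
  have tL: "t \<notin> set L" using unique u ut by blast
  then have tx: "\<not> adj t x" using t S_def set by auto
  have "adj (hd L) (last L)"
    using outside_neighbour_not_consecutive(3)[OF CL] u S_def set lL len no by auto
  moreover have "\<not> adj u (hd L)" "\<not> adj u (last L)" using unique[OF u] ne by auto
  moreover have "u \<notin> set L" "adj x u" using u S_def set adj_sym by auto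
  moreover have "u \<noteq> hd L" "u \<noteq> last L" "t \<noteq> hd L" "t \<noteq> last L" "t \<noteq> x"
    using \<open>u \<notin> set L\<close> tL t ne by auto
  ultimately have "adj t (hd L) \<or> adj t (last L)"
    using Z2_free[of "hd L" "last L" x u t] ut tx xL by (simp add: adj_commute)
  \<comment> \<open>A general \<open>M\<close> covers both orientations of the cycle.\<close>
  moreover have "\<not> adj t (hd M)" if CM: "cyc (x # M)" and M: "set M = set L" "length M = length L" for M
  proof
    assume a: "adj t (hd M)"
    obtain y N where N: "M = y # N" using M lL len by (cases M) auto
    have "chorded_cyc (length N + 3)"
      using consecutive_attachments_extend[of x y N u t] CM N M a u ut t tL S_def set lL len by auto
    moreover have "length N + 3 = Suc (length xs)" using N M lL by simp
    ultimately show False using no by simp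
  qed
  from this[OF CL] this[OF cyc_rev[OF CL]] have "\<not> adj t (hd L)" "\<not> adj t (last L)"
    by (auto simp: hd_rev)
  ultimately show False by blast
qed

section \<open>From a triangle to chorded cycles of all lengths\<close>

text \<open>Without diamonds every vertex lies within distance 1 of the triangle, and each triangle vertex
  has at most two neighbours outside, so there are at most 9 vertices. The line graph of \<open>K\<^sub>3\<^sub>,\<^sub>3\<close>
  attains this bound, hence the hypothesis on the order.\<close>

lemma triangle_imp_diamond:
  assumes T: "adj a b" "adj b c" "adj a c"
  shows "\<exists>u v p q. adj u v \<and> adj u p \<and> adj v p \<and> adj u q \<and> adj v q \<and> p \<noteq> q"
proof (rule ccontr)
  assume "\<not> ?thesis"
  then have nod: "p = q" if "adj u v" "adj u p" "adj v p" "adj u q" "adj v q" for u v p q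
    using that by blast
  define N where "N x = {d \<in> V. adj d x} - {a, b, c}" for x
  \<comment> \<open>An outside neighbour of \<open>z\<close> misses \<open>x\<close>, or else
    \<open>xz\<close> lies in two triangles. Claw-freeness then makes the outside neighbours of
    \<open>z\<close> a clique, and three of them form a \<open>K\<^sub>4\<close> with
    \<open>z\<close>.\<close>
  have le2: "card (N z) \<le> 2" if "adj x y" "adj y z" "adj x z" "{x, y, z} = {a, b, c}" for x y z
  proof (rule ccontr)
    assume "\<not> ?thesis"
    then obtain P where "P \<subseteq> N z" "card P = 3"
      by (metis Suc_eq_plus1 not_less_eq_eq numeral_2_eq_2 numeral_3_eq_3 obtain_subset_with_card_n)
    then obtain p q r where pqr: "p \<in> N z" "q \<in> N z" "r \<in> N z" "p \<noteq> q" "q \<noteq> r" "p \<noteq> r"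
      by (auto simp: card_3_iff)
    have nx: "\<not> adj x d \<and> d \<noteq> x" if d: "d \<in> N z" for d
    proof -
      have "d \<noteq> y" "adj d z" "d \<noteq> x" using d \<open>{x, y, z} = {a, b, c}\<close> by (auto simp: N_def)
      then show ?thesis using nod[of x z d y] that \<open>adj x y\<close> \<open>adj y z\<close> \<open>adj x z\<close> by (auto simp: adj_commute)
    qed
    have "adj d e" if "d \<in> N z" "e \<in> N z" "d \<noteq> e" for d e
      using claw_free[of z x d e] nx that \<open>adj x z\<close> by (auto simp: N_def adj_commute)
    then show False using nod[of p q z r] pqr by (auto simp: N_def adj_commute)
  qed
  have cards: "card (N a) \<le> 2" "card (N b) \<le> 2" "card (N c) \<le> 2"
    using le2[of b c a] le2[of a c b] le2[of a b c] T by (auto simp: adj_commute insert_commute)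
  define S where "S = {a, b, c} \<union> N a \<union> N b \<union> N c"
  have "card S \<le> card {a, b, c} + card (N a) + card (N b) + card (N c)"
    unfolding S_def by (meson add_le_mono card_Un_le le_trans order_refl)
  also have "\<dots> \<le> 9" using cards card_length[of "[a, b, c]"] by simp
  finally have "S \<noteq> V" using order by auto
  moreover have "S \<subseteq> V" using T adj_in adj_in2 by (auto simp: S_def N_def)
  moreover have "S \<noteq> {}" by (auto simp: S_def)
  ultimately obtain d e where de: "d \<in> S" "e \<in> V - S" "adj d e"
    using connected[of "{}" S] by auto
  have e: "\<not> adj e a" "\<not> adj e b" "\<not> adj e c" "e \<notin> {a, b, c}" using de by (auto simp: S_def N_def)
  then have d: "d \<notin> {a, b, c}" using de by (auto simp: adj_commute)
  \<comment> \<open>\<open>Z2_free\<close> with the path \<open>d, e\<close> gives \<open>d\<close>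
    a second neighbour on the triangle, hence a diamond.\<close>
  have no: "\<not> adj d z" if "adj x y" "adj y z" "adj x z" "{x, y, z} = {a, b, c}" for x y z
  proof
    assume "adj d z"
    have "\<forall>t\<in>{x, y, z}. \<not> adj e t" unfolding that(4) using e by simp
    moreover have "e \<notin> {x, y, z}" "d \<notin> {x, y, z}" unfolding that(4) using e d by simp_all
    ultimately have "adj d x \<or> adj d y"
      using Z2_free[of x y z d e] that(1-3) de(3) \<open>adj d z\<close> by (simp add: adj_commute)
    then show False
      using nod[of x z d y] nod[of y z d x] that(1-3) \<open>adj d z\<close> \<open>d \<notin> {x, y, z}\<close>
      by (auto simp: adj_commute)
  qed
  show False
    using no[of b c a] no[of a c b] no[of a b c] T d de by (auto simp: adj_commute insert_commute S_def N_def)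
qed

text \<open>The diamond is a chorded 4-cycle, and \<open>cyc_extend\<close> supplies each further
  length.\<close>

lemma triangle_imp_chorded:
  assumes T: "adj a b" "adj b c" "adj a c" and m: "4 \<le> m" "m \<le> card V"
  shows "chorded_cyc m"
  using m
proof (induction m rule: nat_induct_at_least)
  case base
  obtain u v p q where *: "adj u v" "adj u p" "adj v p" "adj u q" "adj v q" "p \<noteq> q"
    using triangle_imp_diamond[OF T] by blast
  then have "u \<noteq> v" "u \<noteq> p" "u \<noteq> q" "v \<noteq> p" "v \<noteq> q" by auto
  then have "cyc (u # p # [v, q])" using * by (auto simp: cyc_def adj_commute)
  then show ?case using chorded_cycI[of u p "[v, q]" v 4] * \<open>v \<noteq> q\<close> by simp
next
  case (Suc m)
  then obtain xs where "cyc xs" "length xs = m" by (auto simp: chorded_cyc_def)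
  then show ?case using cyc_extend[of xs] Suc by simp
qed

section \<open>The triangle-free case\<close>

text \<open>Otherwise deleting \<open>y\<close> would isolate \<open>x\<close>.\<close>

lemma two_neighbours:
  assumes "x \<in> V" shows "\<exists>t. adj x t \<and> t \<noteq> y"
proof (cases "y \<in> V \<and> y \<noteq> x")
  case True
  have "card V \<le> 2" if "{x} = V - {y}"
    using that True fin by (metis card_Diff_singleton diff_le_self is_singletonI is_singleton_altdef le_diff_conv one_add_one order_refl)
  then have "{x} \<noteq> V - {y}" using order by fastforce
  then show ?thesis using connected[of "{y}" "{x}"] True assms by auto
next
  case False
  have "{x} \<noteq> V" using order by auto
  then obtain t where "t \<in> V" "adj x t" using connected[of "{}" "{x}"] assms by auto
  then show ?thesis using False by (metis adj_irrefl)
qed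

text \<open>All neighbours of the first vertex of a longest path lie on the path, and one beyond its
  successor closes a cycle.\<close>

lemma ex_cyc: "\<exists>xs. cyc xs"
proof -
  define P where "P p \<longleftrightarrow> p \<noteq> [] \<and> distinct p \<and> set p \<subseteq> V \<and> successively adj p" for p
  obtain x0 where "x0 \<in> V" using order by fastforce
  then have "P [x0]" by (simp add: P_def)
  moreover have "\<forall>p. P p \<longrightarrow> length p < Suc (card V)"
    using fin by (auto simp: P_def less_Suc_eq_le) (metis card_mono distinct_card)
  ultimately obtain p where p: "P p" and max: "\<And>p'. P p' \<Longrightarrow> length p' \<le> length p"
    using ex_has_greatest_nat[of P "[x0]" length] by blast
  obtain x q where q: "p = x # q" using p by (cases p) (auto simp: P_def)
  have closed: "t \<in> set q" if "adj x t" for t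
  proof (rule ccontr)
    assume "t \<notin> set q"
    then have "P (t # p)" using p that q by (auto simp: P_def adj_commute successively_Cons intro: adj_in)
    then show False using max by fastforce
  qed
  \<comment> \<open>If \<open>q\<close> is empty, \<open>hd q\<close> is unspecified;
    \<open>two_neighbours\<close> allows any value, and \<open>closed\<close> rules this case
    out.\<close>
  obtain t where t: "adj x t" "t \<noteq> hd q" using two_neighbours[of x "hd q"] p q by (auto simp: P_def)
  obtain A B where q2: "q = A @ t # B" using closed[OF t(1)] by (meson split_list)
  have "A \<noteq> []" using t q2 by auto
  then have "Suc 0 \<le> length A" by (cases A) auto
  then have "cyc (x # A @ [t])"
    using p q q2 t \<open>A \<noteq> []\<close> by (auto simp: P_def cyc_def successively_Cons successively_append_iff adj_commute)
  then show ?thesis ..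
qed

text \<open>Without claws and triangles all degrees are at most 2, so any cycle is chordless and, by
  connectedness, spans the graph.\<close>

lemma triangle_free_imp_cyc:
  assumes notri: "\<And>a b c. \<lbrakk>adj a b; adj b c; adj a c\<rbrakk> \<Longrightarrow> False"
  obtains xs where "cyc xs" "set xs = V"
    "\<And>i j. \<lbrakk>i < length xs; j < length xs; adj (xs ! i) (xs ! j)\<rbrakk>
      \<Longrightarrow> j = Suc i mod length xs \<or> i = Suc j mod length xs"
proof -
  obtain xs where C: "cyc xs" using ex_cyc ..
  define n where "n = length xs"
  have n: "3 \<le> n" and dist: "distinct xs" using C by (auto simp: cyc_def n_def)
  have nbr: "\<exists>j<n. z = xs ! j \<and> (j = Suc i mod n \<or> i = Suc j mod n)"
    if i: "i < n" and z: "adj (xs ! i) z" for i z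
  proof (rule ccontr)
    assume con: "\<not> ?thesis"
    \<comment> \<open>Cyclic successor and predecessor of \<open>i\<close>, distinct because
      \<open>n\<close> is at least 3. With \<open>z\<close> they would be three leaves at
      \<open>xs ! i\<close>.\<close>
    define s where "s = Suc i mod n"
    define p where "p = (if i = 0 then n - 1 else i - 1)"
    have sp: "s < n" "p < n" "Suc p mod n = i" "s \<noteq> p"
      using i n by (auto simp: s_def p_def mod_Suc)
    have "adj (xs ! i) (xs ! s)" "adj (xs ! p) (xs ! i)"
      using cyc_nth[OF C, of i] cyc_nth[OF C, of p] i sp by (auto simp: n_def s_def)
    moreover have "z \<noteq> xs ! s" "z \<noteq> xs ! p" using con sp s_def by auto
    moreover have "xs ! s \<noteq> xs ! p" using dist sp by (auto simp: nth_eq_iff_index_eq n_def)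
    ultimately show False
      using claw_free[of "xs ! i" z "xs ! s" "xs ! p"] z notri by (metis adj_sym)
  qed
  have "set xs = V"
  proof (rule ccontr)
    assume "set xs \<noteq> V"
    moreover have "set xs \<noteq> {}" using n n_def by auto
    ultimately obtain u t where ut: "u \<in> set xs" "t \<in> V - set xs" "adj u t"
      using connected[of "{}" "set xs"] cyc_subset[OF C] by auto
    then obtain i where "i < n" "u = xs ! i" by (auto simp: in_set_conv_nth n_def)
    then show False using nbr[of i t] ut by (auto simp: n_def)
  qed
  moreover have "j = Suc i mod n \<or> i = Suc j mod n" if "i < n" "j < n" "adj (xs ! i) (xs ! j)" for i j
    using nbr[OF that(1,3)] that dist by (auto simp: nth_eq_iff_index_eq n_def)
  ultimately show ?thesis using C that n_def by blast
qed

end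

section \<open>Translation to symmetric digraphs\<close>

text \<open>The map \<open>g\<close> enumerates \<open>G\<close> by the vertices of the model graph
  \<open>H\<close>, so the isomorphism is its inverse, applied to both ends of each arc.\<close>

lemma digraph_isoI:
  assumes wf: "pair_wf_digraph G" "pair_wf_digraph H" and bij: "bij_betw g (pverts H) (pverts G)"
    and arcs: "\<And>i j. \<lbrakk>i \<in> pverts H; j \<in> pverts H\<rbrakk> \<Longrightarrow> (g i, g j) \<in> parcs G \<longleftrightarrow> (i, j) \<in> parcs H"
  shows "digraph_iso (with_proj G) (with_proj H)"
proof -
  interpret G: pair_wf_digraph G by fact
  interpret H: pair_wf_digraph H by fact
  define f where "f = the_inv_into (pverts H) g"
  have f: "bij_betw f (pverts G) (pverts H)" unfolding f_def by (rule bij_betw_the_inv_into[OF bij])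
  have gf: "g (f u) = u" if "u \<in> pverts G" for u
    unfolding f_def using bij that by (meson bij_betw_def f_the_inv_into_f_bij_betw)
  have fg: "f (g i) = i" if "i \<in> pverts H" for i
    unfolding f_def using bij that by (simp add: bij_betw_def the_inv_into_f_f)
  have fin: "f u \<in> pverts H" if "u \<in> pverts G" for u using f that by (auto simp: bij_betw_def)
  have gin: "g i \<in> pverts G" if "i \<in> pverts H" for i using bij that by (auto simp: bij_betw_def)
  have img: "map_prod f f ` parcs G = parcs H"
  proof (intro equalityI subrelI)
    fix i j assume "(i, j) \<in> map_prod f f ` parcs G"
    then obtain u v where "(u, v) \<in> parcs G" "i = f u" "j = f v" by auto
    then show "(i, j) \<in> parcs H" using arcs[of i j] gf fin G.wellformed' by metis
  next
    fix i j assume ij: "(i, j) \<in> parcs H"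
    then have "i \<in> pverts H" "j \<in> pverts H" using H.wellformed' by blast+
    then have "(g i, g j) \<in> parcs G" "(i, j) = map_prod f f (g i, g j)" using arcs ij fg by auto
    then show "(i, j) \<in> map_prod f f ` parcs G" by blast
  qed
  have inj: "inj_on (map_prod f f) (parcs G)"
  proof (rule inj_onI)
    fix e e' assume *: "e \<in> parcs G" "e' \<in> parcs G" "map_prod f f e = map_prod f f e'"
    have "inj_on f (pverts G)" using f by (simp add: bij_betw_def)
    then show "e = e'" using * G.arc_fst_in_verts G.arc_snd_in_verts
      by (auto simp: map_prod_def split_beta prod_eq_iff dest: inj_onD)
  qed
  let ?h = "\<lparr>iso_verts = f, iso_arcs = map_prod f f, iso_head = snd, iso_tail = fst\<rparr>"
  have "pre_digraph.digraph_isomorphism (with_proj G) ?h"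
    using f inj G.wf_digraph by (auto simp: pre_digraph.digraph_isomorphism_def bij_betw_def)
  moreover have "with_proj H = app_iso ?h (with_proj G)"
    using img f by (simp add: app_iso_def with_proj_def bij_betw_def)
  ultimately show ?thesis unfolding digraph_iso_def by blast
qed

text \<open>An explicit embedding of \<open>H\<close> would make the subgraph induced on its image a
  forbidden copy.\<close>

lemma free_ofD:
  assumes "free_of \<H> G" "H \<in> \<H>" and wf: "pair_wf_digraph G" "pair_wf_digraph H"
    and inj: "inj_on g (pverts H)" and sub: "g ` pverts H \<subseteq> pverts G"
    and arcs: "\<And>i j. \<lbrakk>i \<in> pverts H; j \<in> pverts H\<rbrakk> \<Longrightarrow> (g i, g j) \<in> parcs G \<longleftrightarrow> (i, j) \<in> parcs H"
  shows False
proof -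
  let ?S = "g ` pverts H"
  let ?G = "\<lparr>pverts = ?S, parcs = parcs G \<inter> ?S \<times> ?S\<rparr>"
  have eq: "with_proj G \<restriction> ?S = with_proj ?G"
    by (auto simp: induce_subgraph_def with_proj_def)
  have "pair_wf_digraph ?G" by unfold_locales auto
  then have "digraph_iso (with_proj ?G) (with_proj H)"
    using wf(2) inj arcs by (intro digraph_isoI[where g = g]) (auto simp: bij_betw_def)
  then show False using assms(1,2) sub unfolding free_of_def by (metis eq)
qed

text \<open>A set that no arc leaves is closed under reachability.\<close>

lemma k_connectedD:
  assumes "k_connected k G" "pair_graph G" "X \<subseteq> pverts G" "card X < k"
    and S: "S \<subseteq> pverts G - X" "S \<noteq> {}" "S \<noteq> pverts G - X"
  shows "\<exists>u\<in>S. \<exists>t\<in>pverts G - X - S. (u, t) \<in> parcs G"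
proof (rule ccontr)
  assume con: "\<not> ?thesis"
  interpret pair_graph G by fact
  let ?H = "with_proj G \<restriction> (pverts G - X)"
  have "connected ?H" using assms unfolding k_connected_def by blast
  obtain u t where u: "u \<in> S" and t: "t \<in> pverts G - X - S" using S by blast
  then have "(u, t) \<in> rtrancl_on (verts ?H) ((arcs_ends ?H)\<^sup>s)"
    using \<open>connected ?H\<close> S unfolding connected_conv by auto
  then have "t \<in> S" using u
  proof (induction rule: rtrancl_on.induct)
    case (rtrancl_on_into_rtrancl_on y z)
    \<comment> \<open>Connectedness is reachability in the symmetric closure, which adds nothing
      since \<open>G\<close> is symmetric.\<close>
    have "symcl (arcs_ends ?H) \<subseteq> parcs G"
      using pair_sym_arcs by (auto simp: symmetric_def symcl_def arcs_ends_def arc_to_ends_def dest: symD)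
    then show ?case using rtrancl_on_into_rtrancl_on con by auto
  qed simp
  then show False using t by blast
qed

text \<open>Zipping a vertex list with its shift gives the arcs of a walk. The end \<open>z\<close>
  is separate from \<open>x\<close> because the induction moves the start; later both
  coincide.\<close>

lemma pcas_zip: "pcas x (zip (x # ys) (ys @ [z])) z"
  by (induction ys arbitrary: x) auto

lemma pawalk_verts_zip: "pawalk_verts x (zip (x # ys) (ys @ [z])) = x # ys @ [z]"
  by (induction ys arbitrary: x) auto

lemma set_zip_successively:
  "successively (\<lambda>u v. (u, v) \<in> E) (x # ys @ [z]) \<Longrightarrow> set (zip (x # ys) (ys @ [z])) \<subseteq> E"
  by (induction ys arbitrary: x) auto

theorem theorem7:
  fixes G :: "'a pair_pre_digraph"
  assumes "pair_graph G"
    and "k_connected 2 G"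
    and "card (pverts G) \<ge> 10"
    and "free_of {claw, Z_graph 2} G"
  shows "digraph_iso (with_proj G) (with_proj (cycle_graph (card (pverts G)))) \<or> chorded_pancyclic G"
proof -
  interpret G: pair_graph G by fact
  have wf: "pair_wf_digraph G" by unfold_locales
  define adj where "adj u v \<longleftrightarrow> (u, v) \<in> parcs G" for u v
  have sym: "adj v u" if "adj u v" for u v
    using that G.pair_sym_arcs by (auto simp: adj_def symmetric_def dest: symD)
  then have com: "adj u v \<longleftrightarrow> adj v u" for u v by blast
  have irr: "\<not> adj v v" for v
    using G.pair_no_loops by (fastforce simp: adj_def)
  have adj_in: "u \<in> pverts G" if "adj u v" for u v
    using that G.in_arcsD1 by (auto simp: adj_def)
  interpret T: two_connected_claw_Z2_free "pverts G" adj
  proof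
    show "finite (pverts G)" by (rule G.pair_finite_verts)
  next
    fix x a b c assume *: "adj x a" "adj x b" "adj x c" "a \<noteq> b" "a \<noteq> c" "b \<noteq> c"
    show "adj a b \<or> adj a c \<or> adj b c"
    proof (rule ccontr)
      assume con: "\<not> ?thesis"
      have inV: "x \<in> pverts G" "a \<in> pverts G" "b \<in> pverts G" "c \<in> pverts G"
        using * adj_in sym by blast+
      have ne: "x \<noteq> a" "x \<noteq> b" "x \<noteq> c" using * irr by auto
      have wfc: "pair_wf_digraph claw" by unfold_locales (auto simp: claw_def undirected_def)
      show False
        by (rule free_ofD[OF assms(4) _ wf wfc, of "(!) [x, a, b, c]"])
          (use * con inV ne in \<open>auto simp: claw_def undirected_def inj_on_def irr com simp flip: adj_def\<close>)
    qed
  next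
    fix a b c d e assume *: "adj a b" "adj b c" "adj a c" "adj c d" "adj d e" "d \<notin> {a, b}" "e \<notin> {a, b, c}"
    show "adj d a \<or> adj d b \<or> adj e a \<or> adj e b \<or> adj e c"
    proof (rule ccontr)
      assume con: "\<not> ?thesis"
      have inV: "a \<in> pverts G" "b \<in> pverts G" "c \<in> pverts G" "d \<in> pverts G" "e \<in> pverts G"
        using * adj_in sym by blast+
      have ne: "a \<noteq> b" "a \<noteq> c" "b \<noteq> c" "c \<noteq> d" "d \<noteq> e" using * irr by auto
      have wfZ: "pair_wf_digraph (Z_graph 2)"
        using pair_graph_Z_graph by (simp add: pair_graph_def pair_digraph_def pair_fin_digraph_def)
      have v: "pverts (Z_graph 2) = {0, 1, 2, 3, 4}" by (auto simp: Z_graph_def undirected_def)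
      have "{(j, j + 1) |j. 2 \<le> j \<and> j < 2 + 2} = {(2, 3), (3, 4 :: nat)}" by auto
      then have p: "parcs (Z_graph 2) =
        {(0,1),(0,2),(1,2),(2,3),(3,4),(1,0),(2,0),(2,1),(3,2),(4,3)}"
        by (auto simp: Z_graph_def undirected_def)
      show False
      proof (rule free_ofD[OF assms(4) _ wf wfZ, of "(!) [a, b, c, d, e]"])
        fix i j assume "i \<in> pverts (Z_graph 2)" "j \<in> pverts (Z_graph 2)"
        then show "([a, b, c, d, e] ! i, [a, b, c, d, e] ! j) \<in> parcs G \<longleftrightarrow> (i, j) \<in> parcs (Z_graph 2)"
          unfolding v p adj_def[symmetric] by (elim insertE emptyE) (use * con irr com in simp_all)
      qed (use * ne inV in \<open>auto simp: v inj_on_def\<close>)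
    qed
  next
    fix X S assume "X \<subseteq> pverts G" "card X < 2" "S \<subseteq> pverts G - X" "S \<noteq> {}" "S \<noteq> pverts G - X"
    then show "\<exists>u\<in>S. \<exists>t\<in>pverts G - X - S. adj u t"
      unfolding adj_def using k_connectedD[OF assms(2,1)] by blast
  qed (auto simp: com irr assms(3) intro: adj_in)
  show ?thesis
  proof (cases "\<exists>a b c. adj a b \<and> adj b c \<and> adj a c")
    case True
    have "\<exists>p. chorded_cycle G p \<and> length p = m" if m: "4 \<le> m" "m \<le> card (pverts G)" for m
    proof -
      obtain x w B l z where C: "T.cyc (x # w # B @ [l])" and z: "z \<in> set B" "adj x z"
        and len: "length (x # w # B @ [l]) = m"
        using True T.triangle_imp_chorded m unfolding T.chorded_cyc_def by metis
      let ?ys = "w # B @ [l]"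
      define p where "p = zip (x # ?ys) (?ys @ [x])"
      have "set p \<subseteq> parcs G"
        unfolding p_def
        by (rule set_zip_successively)
          (use C in \<open>auto simp: T.cyc_def successively_Cons successively_append_iff adj_def hd_append\<close>)
      moreover have "pcas x p x" unfolding p_def by (rule pcas_zip)
      moreover have "x \<in> pverts G" using z adj_in by blast
      ultimately have "G.awalk x p x" by (simp add: G.awalk_def)
      moreover have "distinct (tl (pawalk_verts x p))"
        unfolding p_def pawalk_verts_zip using C by (auto simp: T.cyc_def)
      moreover have "length p = m" using len by (simp add: p_def)
      ultimately have cycle: "G.cycle p" and "length p = m" unfolding G.cycle_def using m by auto
      have "fst ` set p = set (x # ?ys)"
        unfolding p_def by (simp flip: set_map)
      \<comment> \<open>The only arc of \<open>p\<close> leaving \<open>x\<close> is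
        \<open>(x, w)\<close> and the only one entering it is \<open>(l, x)\<close>, hence the two
        decompositions of \<open>p\<close>.\<close>
      moreover have "(x, z) \<notin> set p" "(z, x) \<notin> set p"
      proof -
        have d: "distinct (x # ?ys)" using C by (simp add: T.cyc_def)
        have p: "p = (x, w) # zip ?ys (B @ [l, x])" by (simp add: p_def)
        show "(x, z) \<notin> set p" using d z unfolding p by (auto dest: set_zip_leftD)
        have p: "p = zip (x # w # B) ?ys @ [(l, x)]"
          using zip_append[of "x # w # B" ?ys "[l]" "[x]"] by (simp add: p_def)
        show "(z, x) \<notin> set p" using d z unfolding p by (auto dest!: set_zip_rightD)
      qed
      ultimately have "\<exists>u v. u \<in> fst ` set p \<and> v \<in> fst ` set p \<and> (u, v) \<in> parcs G \<and>
          (u, v) \<notin> set p \<and> (v, u) \<notin> set p"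
        using z by - (rule exI[of _ x], rule exI[of _ z], simp add: adj_def)
      then have "chorded_cycle G p"
        unfolding chorded_cycle_def using cycle m \<open>length p = m\<close> by simp
      then show ?thesis using \<open>length p = m\<close> by blast
    qed
    then show ?thesis by (simp add: chorded_pancyclic_def)
  next
    case False
    obtain xs where xs: "T.cyc xs" "set xs = pverts G"
      and cons: "\<And>i j. \<lbrakk>i < length xs; j < length xs; adj (xs ! i) (xs ! j)\<rbrakk>
        \<Longrightarrow> j = Suc i mod length xs \<or> i = Suc j mod length xs"
      using T.triangle_free_imp_cyc False by metis
    let ?n = "card (pverts G)"
    have dist: "distinct xs" and n: "?n = length xs" "3 \<le> length xs"
      using xs distinct_card by (fastforce simp: T.cyc_def)+
    have "pair_wf_digraph (cycle_graph ?n)"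
      using pair_graph_cycle_graph[of ?n] n by (simp add: pair_graph_def pair_digraph_def pair_fin_digraph_def)
    moreover have "bij_betw ((!) xs) (pverts (cycle_graph ?n)) (pverts G)"
      using bij_betw_nth[OF dist] xs n by (simp add: cycle_graph_def undirected_def)
    \<comment> \<open>\<open>cons\<close> says that all edges join cyclically consecutive positions,
      \<open>T.cyc_nth\<close> that all such pairs are edges.\<close>
    moreover have "(xs ! i, xs ! j) \<in> parcs G \<longleftrightarrow> (i, j) \<in> parcs (cycle_graph ?n)"
      if "i \<in> pverts (cycle_graph ?n)" "j \<in> pverts (cycle_graph ?n)" for i j
      using that cons[of i j] T.cyc_nth[OF xs(1), of i] T.cyc_nth[OF xs(1), of j] sym n
      by (auto simp: cycle_graph_def undirected_def adj_def)
    ultimately show ?thesis using digraph_isoI wf by blast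
  qed
qed

end
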